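(* Consider the sparse high-dimensional regression model with Gaussian noise: $Y=X\beta+\varepsilon$ with $\varepsilon\sim\mathcal N(0,I_n)$, $X$ an $n\times p$ design matrix with $(X^\top X)_{i,i}=n$ for all $i=1,\dots,p$, and parameter space $\beta\in\Theta(s)$. There is an absolute constant $p_0$ such that the following holds for all $p\ge p_0$. Let $0<s\le\sqrt p/2$ and $\mathrm{mc}(X)\le 1/(s^2\log(p/s^2))$. Given an estimator $\widehat\beta$ and a real number $\gamma$ such that $4\gamma+1/\log(p/s^2)\le0.99$ and $$\sup_{\beta\in\Theta(s)}\big\|E_\beta[\widehat\beta]-\beta\big\|_2^2\le\frac{\gamma s}{n}\log\Big(\frac p{s^2}\Big),$$ one has $$\sum_{i=1}^p\mathrm{Var}_0(\widehat\beta_i)\ \ge\ \frac{1-(1/2)^{0.01}}{25\,e^2\,\log(p/s^2)}\;\frac pn\Big(\frac{s^2}p\Big)^{4\gamma},$$ where $\mathrm{Var}_0$ denotes the variance for parameter vector $\beta=(0,\dots,0)^\top$.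
   Context: $s$ is an integer and $\Theta(s)$ is the set of all vectors $\beta\in\mathbb R^p$ with at most $s$ non-zero components. The design $X$ is deterministic, $Y$ is the observed vector in $\mathbb R^n$. The mutual coherence is $\mathrm{mc}(X):=\max_{1\le i\ne j\le p}(X^\top X)_{i,j}/(X^\top X)_{i,i}$. An estimator $\widehat\beta=(\widehat\beta_1,\dots,\widehat\beta_p)$ is a measurable function of $Y$ with values in $\mathbb R^p$ (not required to be sparse) with finite expectation $E_\beta[\widehat\beta]$ for all $\beta\in\Theta(s)$. Variances of non-square-integrable variables are $+\infty$. $\|\cdot\|_2$ is the Euclidean norm. *)

theory Defs
  imports "HOL-Probability.Probability"
begin

text \<open>
  The dimensions \<open>n\<close> and \<open>p\<close> vary inside the statement, so \<open>\<real>\<^sup>d\<close> is the space of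
  \<open>\<Pi>\<^sub>M i\<in>{..<d}. borel\<close>, i.e. the extensional functions on \<open>{..<d}\<close>, with 0-based indices.
  An \<open>n \<times> p\<close> matrix is a function \<open>X\<close> of which only the entries \<open>X k i\<close> with \<open>k < n\<close>, \<open>i < p\<close>
  are ever used.
\<close>

abbreviation borel_vec :: "nat \<Rightarrow> (nat \<Rightarrow> real) measure" where
  "borel_vec d \<equiv> Pi\<^sub>M {..<d} (\<lambda>_. borel)"

definition zero_vec :: "nat \<Rightarrow> nat \<Rightarrow> real" where
  "zero_vec d = (\<lambda>i\<in>{..<d}. 0)"

definition sparse_vecs :: "nat \<Rightarrow> nat \<Rightarrow> (nat \<Rightarrow> real) set" where
  "sparse_vecs p s = {\<beta> \<in> space (borel_vec p). card {i. i < p \<and> \<beta> i \<noteq> 0} \<le> s}"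

definition gram :: "nat \<Rightarrow> (nat \<Rightarrow> nat \<Rightarrow> real) \<Rightarrow> nat \<Rightarrow> nat \<Rightarrow> real" where
  "gram n X i j = (\<Sum>k<n. X k i * X k j)"

text \<open>There is no absolute value in the numerator. The value is meaningful only for \<open>p \<ge> 2\<close>,
  since otherwise the maximum is over the empty set.\<close>

definition mutual_coherence :: "nat \<Rightarrow> nat \<Rightarrow> (nat \<Rightarrow> nat \<Rightarrow> real) \<Rightarrow> real" where
  "mutual_coherence n p X =
     Max {gram n X i j / gram n X i i | i j. i < p \<and> j < p \<and> i \<noteq> j}"

definition std_gaussian_vec :: "nat \<Rightarrow> (nat \<Rightarrow> real) measure" where
  "std_gaussian_vec n =
     Pi\<^sub>M {..<n} (\<lambda>_. density lborel (\<lambda>x. ennreal (std_normal_density x)))"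

text \<open>The law of \<open>Y = X \<beta> + \<epsilon>\<close> for \<open>\<epsilon> \<sim> N(0, I\<^sub>n)\<close>.\<close>

definition regression_law ::
    "nat \<Rightarrow> nat \<Rightarrow> (nat \<Rightarrow> nat \<Rightarrow> real) \<Rightarrow> (nat \<Rightarrow> real) \<Rightarrow> (nat \<Rightarrow> real) measure" where
  "regression_law n p X \<beta> =
     distr (std_gaussian_vec n) (borel_vec n)
       (\<lambda>\<epsilon>. \<lambda>k\<in>{..<n}. (\<Sum>j<p. X k j * \<beta> j) + \<epsilon> k)"

definition is_estimator ::
    "nat \<Rightarrow> nat \<Rightarrow> (nat \<Rightarrow> nat \<Rightarrow> real) \<Rightarrow> nat \<Rightarrow> ((nat \<Rightarrow> real) \<Rightarrow> nat \<Rightarrow> real) \<Rightarrow> bool" where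
  "is_estimator n p X s b \<longleftrightarrow>
     b \<in> borel_vec n \<rightarrow>\<^sub>M borel_vec p \<and>
     (\<forall>\<beta>\<in>sparse_vecs p s. \<forall>i<p. integrable (regression_law n p X \<beta>) (\<lambda>y. b y i))"

definition ext_variance :: "'a measure \<Rightarrow> ('a \<Rightarrow> real) \<Rightarrow> ennreal" where
  "ext_variance M f =
     (if integrable M (\<lambda>y. (f y)\<^sup>2)
      then ennreal (\<integral>y. (f y - (\<integral>z. f z \<partial>M))\<^sup>2 \<partial>M)
      else \<infinity>)"

end

theory Submission
  imports Defs
begin

text \<open>
  Write \<open>L = ln (p / s\<^sup>2)\<close>. Cut (most of) the coordinates into \<open>s\<close> blocks of size
  \<open>m = \<lfloor>p / s\<rfloor>\<close> and let \<open>\<beta>\<^sub>f\<close> have exactly one entry \<open>t = sqrt ((4\<gamma>L + 1) / n)\<close> in each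
  block, at the position chosen by \<open>f\<close>. For a coordinate \<open>i\<close>, compare \<open>P\<^sub>0\<close> with the mixture of the
  laws \<open>P\<^sub>f\<close> over all \<open>f\<close> that select \<open>i\<close>. On average over \<open>i\<close> the bias bound forces the mean of
  the \<open>i\<close>-th component of the estimator to change by a constant times \<open>1 / sqrt n\<close>. By Cauchy--Schwarz this
  change is at most the standard deviation under \<open>P\<^sub>0\<close> times the \<open>L\<^sup>2(P\<^sub>0)\<close> norm of the density of
  the mixture. The squared norm is an average over two independent choices \<open>f\<close>, \<open>g\<close> of the
  exponential of the inner product of \<open>X \<beta>\<^sub>f\<close> and \<open>X \<beta>\<^sub>g\<close>. Up to a coherence term, which contributes
  a factor of at most \<open>e\<close>, this product counts the blocks in which \<open>f\<close> and \<open>g\<close> agree, so the average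
  factorizes over the blocks and is at most \<open>e\<^sup>3 (p / s\<^sup>2)\<^bsup>4\<gamma>\<^esup>\<close>.
\<close>

section \<open>Gaussian shifts and their likelihood ratios\<close>

text \<open>The likelihood ratio of N(v, I) against N(0, I) in dimension \<open>n\<close>. It is
  written as a product over coordinates so that its integrals against a product measure
  factorize.\<close>

definition gaussian_tilt :: "nat \<Rightarrow> (nat \<Rightarrow> real) \<Rightarrow> (nat \<Rightarrow> real) \<Rightarrow> real" where
  "gaussian_tilt n v y = (\<Prod>k<n. exp (v k * y k - (v k)\<^sup>2 / 2))"

lemma gaussian_tilt_pos: "0 < gaussian_tilt n v y"
  by (auto simp: gaussian_tilt_def intro: prod_pos)

text \<open>Completing the square in each coordinate. Since every tilt integrates to 1, this makes
  \<open>exp\<close> of the inner product of \<open>v\<close> and \<open>w\<close> the inner product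
  of the two tilts in L2 of the standard Gaussian.\<close>

lemma gaussian_tilt_mult:
  "gaussian_tilt n v y * gaussian_tilt n w y =
     exp (\<Sum>k<n. v k * w k) * gaussian_tilt n (\<lambda>k. v k + w k) y"
  unfolding gaussian_tilt_def
  by (simp add: exp_sum prod.distrib[symmetric] exp_add[symmetric])
    (intro prod.cong refl arg_cong[where f=exp], simp add: power2_eq_square field_simps)

lemma sets_std_gaussian_vec [measurable_cong]: "sets (std_gaussian_vec n) = sets (borel_vec n)"
  by (auto simp: std_gaussian_vec_def intro!: sets_PiM_cong)

lemma space_std_gaussian_vec: "space (std_gaussian_vec n) = space (borel_vec n)"
  by (rule sets_eq_imp_space_eq[OF sets_std_gaussian_vec])

lemma gaussian_tilt_measurable [measurable]:
  "gaussian_tilt n v \<in> borel_measurable (std_gaussian_vec n)"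
  unfolding gaussian_tilt_def by measurable

lemma prob_space_std_gaussian_vec: "prob_space (std_gaussian_vec n)"
  unfolding std_gaussian_vec_def
  by (intro prob_space_PiM prob_space_normal_density) simp

text \<open>Substituting \<open>x - v\<close> for \<open>x\<close> moves the shift from the set to
  the density, and the shifted normal density is the centred one times
  \<open>exp (v * x - v^2 / 2)\<close>. This is the one-dimensional case of the next lemma.\<close>

lemma nn_integral_std_normal_translate:
  assumes [measurable]: "A \<in> sets borel"
  shows "(\<integral>\<^sup>+x. ennreal (std_normal_density x) * indicator A (v + x) \<partial>lborel) =
    (\<integral>\<^sup>+x. ennreal (std_normal_density x) * (ennreal (exp (v * x - v\<^sup>2 / 2)) * indicator A x) \<partial>lborel)"
proof -
  have *: "ennreal (std_normal_density (x - v)) =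
      ennreal (std_normal_density x) * ennreal (exp (v * x - v\<^sup>2 / 2))" for x
    by (simp add: std_normal_density_def ennreal_mult'[symmetric] exp_add[symmetric]
        power2_eq_square field_simps)
  have "(\<integral>\<^sup>+x. ennreal (std_normal_density (x - v)) * indicator A x \<partial>lborel) =
     (\<integral>\<^sup>+x. ennreal (std_normal_density x) * indicator A (v + x) \<partial>lborel)"
    by (subst nn_integral_real_affine[where c=1 and t=v]) auto
  then show ?thesis by (simp add: * mult.assoc)
qed

text \<open>Both sides are identified with the product of the one-dimensional shifted normal laws
  \<open>?Q k\<close>, by computing their values on boxes.\<close>

lemma std_gaussian_vec_translate:
  "distr (std_gaussian_vec n) (borel_vec n) (\<lambda>\<epsilon>. \<lambda>k\<in>{..<n}. v k + \<epsilon> k) =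
     density (std_gaussian_vec n) (\<lambda>y. ennreal (gaussian_tilt n v y))" (is "?D = ?T")
proof -
  let ?N = "density lborel (\<lambda>x. ennreal (std_normal_density x))"
  let ?Q = "\<lambda>k. distr ?N borel (\<lambda>x. v k + x)"
  have pN: "prob_space ?N" by (rule prob_space_normal_density) simp
  have pQ: "prob_space (?Q k)" for k
    by (rule prob_space.prob_space_distr[OF pN]) simp
  interpret N: product_prob_space "\<lambda>_::nat. ?N"
    by (rule product_prob_spaceI) (rule pN)
  interpret Q: product_prob_space ?Q
    by (rule product_prob_spaceI) (rule pQ)
  have sQ: "sets (borel_vec n) = sets (PiM {..<n} ?Q)"
    by (intro sets_PiM_cong) auto
  have tm: "(\<lambda>\<epsilon>. \<lambda>k\<in>{..<n}. v k + \<epsilon> k) \<in> std_gaussian_vec n \<rightarrow>\<^sub>M borel_vec n"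
    by measurable
  have Q_eq: "emeasure (?Q k) A = (\<integral>\<^sup>+x. ennreal (std_normal_density x) * indicator A (v k + x) \<partial>lborel)"
    if "A \<in> sets borel" for k A
    using that by (simp add: emeasure_distr emeasure_density indicator_vimage vimage_def)
       (auto intro!: nn_integral_cong simp: indicator_def)
  have "?D = PiM {..<n} ?Q"
  proof (rule Q.PiM_eqI)
    fix A assume A: "\<And>i. i \<in> {..<n} \<Longrightarrow> A i \<in> sets (?Q i)"
    let ?B = "\<lambda>k. (\<lambda>x. v k + x) -` A k"
    have B: "?B k \<in> sets ?N" if "k < n" for k
      using A that by (auto intro!: measurable_sets_borel[where M="borel"])
    have "emeasure ?D (PiE {..<n} A) =
        emeasure (std_gaussian_vec n) ((\<lambda>\<epsilon>. \<lambda>k\<in>{..<n}. v k + \<epsilon> k) -` (PiE {..<n} A) \<inter> space (std_gaussian_vec n))"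
      using A by (intro emeasure_distr tm) (auto intro!: sets_PiM_I_finite)
    also have "(\<lambda>\<epsilon>. \<lambda>k\<in>{..<n}. v k + \<epsilon> k) -` (PiE {..<n} A) \<inter> space (std_gaussian_vec n) = PiE {..<n} ?B"
      by (auto simp: space_std_gaussian_vec space_PiM PiE_iff)
    also have "emeasure (std_gaussian_vec n) \<dots> = (\<Prod>k<n. emeasure ?N (?B k))"
      unfolding std_gaussian_vec_def using B by (intro N.emeasure_PiM) auto
    also have "\<dots> = (\<Prod>k<n. emeasure (?Q k) (A k))"
      using A by (intro prod.cong refl) (simp add: emeasure_distr)
    finally show "emeasure ?D (PiE {..<n} A) = (\<Prod>k<n. emeasure (?Q k) (A k))" .
  qed (auto simp: sQ)
  moreover have "?T = PiM {..<n} ?Q"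
  proof (rule Q.PiM_eqI)
    fix A assume "\<And>i. i \<in> {..<n} \<Longrightarrow> A i \<in> sets (?Q i)"
    then have A[measurable]: "A i \<in> sets borel" if "i < n" for i
      using that by auto
    let ?f = "\<lambda>k x. ennreal (exp (v k * x - (v k)\<^sup>2 / 2)) * indicator (A k) x"
    have "emeasure ?T (PiE {..<n} A) =
        (\<integral>\<^sup>+y. ennreal (gaussian_tilt n v y) * indicator (PiE {..<n} A) y \<partial>std_gaussian_vec n)"
      by (intro emeasure_density) (auto simp: sets_std_gaussian_vec intro!: sets_PiM_I_finite)
    also have "\<dots> = (\<integral>\<^sup>+y. (\<Prod>k<n. ?f k (y k)) \<partial>std_gaussian_vec n)"
    proof (rule nn_integral_cong)
      fix y assume y: "y \<in> space (std_gaussian_vec n)"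
      have "(indicator (PiE {..<n} A) y :: ennreal) = (\<Prod>k<n. indicator (A k) (y k))"
        using y by (auto simp: indicator_def space_std_gaussian_vec space_PiM PiE_iff prod_zero_iff)
      then show "ennreal (gaussian_tilt n v y) * indicator (PiE {..<n} A) y = (\<Prod>k<n. ?f k (y k))"
        by (simp add: gaussian_tilt_def prod_ennreal prod.distrib)
    qed
    also have "\<dots> = (\<Prod>k<n. \<integral>\<^sup>+x. ?f k x \<partial>?N)"
      unfolding std_gaussian_vec_def
    proof (rule N.product_nn_integral_prod)
      fix i assume "i \<in> {..<n}"
      then have [measurable]: "A i \<in> sets borel" by simp
      show "?f i \<in> borel_measurable ?N" by measurable
    qed simp
    also have "\<dots> = (\<Prod>k<n. emeasure (?Q k) (A k))"
    proof (rule prod.cong)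
      fix k assume "k \<in> {..<n}"
      then have [measurable]: "A k \<in> sets borel" by simp
      show "(\<integral>\<^sup>+x. ?f k x \<partial>?N) = emeasure (?Q k) (A k)"
        by (simp add: Q_eq nn_integral_std_normal_translate nn_integral_density)
    qed simp
    finally show "emeasure ?T (PiE {..<n} A) = (\<Prod>k<n. emeasure (?Q k) (A k))" .
  qed (auto simp: sQ sets_std_gaussian_vec)
  ultimately show ?thesis by simp
qed

lemma regression_law_density:
  "regression_law n p X \<beta> =
     density (std_gaussian_vec n) (\<lambda>y. ennreal (gaussian_tilt n (\<lambda>k. \<Sum>j<p. X k j * \<beta> j) y))"
  unfolding regression_law_def by (rule std_gaussian_vec_translate)

lemma regression_law_zero: "regression_law n p X (zero_vec p) = std_gaussian_vec n"
  by (simp add: regression_law_density zero_vec_def gaussian_tilt_def density_1)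

lemma has_bochner_integral_gaussian_tilt:
  "has_bochner_integral (std_gaussian_vec n) (gaussian_tilt n v) 1"
proof (rule has_bochner_integral_nn_integral)
  have "prob_space (density (std_gaussian_vec n) (\<lambda>y. ennreal (gaussian_tilt n v y)))"
    unfolding std_gaussian_vec_translate[symmetric]
    by (rule prob_space.prob_space_distr[OF prob_space_std_gaussian_vec]) measurable
  from prob_space.emeasure_space_1[OF this]
  show "(\<integral>\<^sup>+y. ennreal (gaussian_tilt n v y) \<partial>std_gaussian_vec n) = ennreal 1"
    by (simp add: emeasure_density cong: nn_integral_cong)
qed (auto intro: less_imp_le gaussian_tilt_pos)

lemma has_bochner_integral_gaussian_tilt_mult:
  "has_bochner_integral (std_gaussian_vec n) (\<lambda>y. gaussian_tilt n v y * gaussian_tilt n w y)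
     (exp (\<Sum>k<n. v k * w k))"
proof -
  have "has_bochner_integral (std_gaussian_vec n)
      (\<lambda>y. exp (\<Sum>k<n. v k * w k) * gaussian_tilt n (\<lambda>k. v k + w k) y) (exp (\<Sum>k<n. v k * w k) * 1)"
    by (intro has_bochner_integral_mult_right has_bochner_integral_gaussian_tilt)
  then show ?thesis by (simp add: gaussian_tilt_mult)
qed

text \<open>Moves every expectation to the single measure P0, where expectations for different
  parameters can be averaged and compared.\<close>

lemma regression_law_integral:
  assumes "f \<in> borel_measurable (borel_vec n)"
  shows "(\<integral>y. f y \<partial>regression_law n p X \<beta>) =
      (\<integral>y. gaussian_tilt n (\<lambda>k. \<Sum>j<p. X k j * \<beta> j) y * f y \<partial>std_gaussian_vec n)"
    and "integrable (regression_law n p X \<beta>) f \<longleftrightarrow>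
      integrable (std_gaussian_vec n) (\<lambda>y. gaussian_tilt n (\<lambda>k. \<Sum>j<p. X k j * \<beta> j) y * f y)"
proof -
  have "f \<in> borel_measurable (std_gaussian_vec n)"
    using assms by (simp add: measurable_cong_sets[OF sets_std_gaussian_vec refl])
  then show "(\<integral>y. f y \<partial>regression_law n p X \<beta>) =
      (\<integral>y. gaussian_tilt n (\<lambda>k. \<Sum>j<p. X k j * \<beta> j) y * f y \<partial>std_gaussian_vec n)"
    "integrable (regression_law n p X \<beta>) f \<longleftrightarrow>
      integrable (std_gaussian_vec n) (\<lambda>y. gaussian_tilt n (\<lambda>k. \<Sum>j<p. X k j * \<beta> j) y * f y)"
    by (simp_all add: regression_law_density integral_density integrable_density
        gaussian_tilt_pos less_imp_le)
qed

section \<open>Cauchy-Schwarz inequalities\<close>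

lemma quadratic_form_discriminant:
  fixes V A K :: real
  assumes "\<And>c. 0 \<le> c\<^sup>2 * V - 2 * c * A + K" "0 \<le> V"
  shows "A\<^sup>2 \<le> V * K"
proof (cases "V = 0")
  case True
  have "A = 0"
  proof (rule ccontr)
    assume "A \<noteq> 0"
    \<comment> \<open>With \<open>V = 0\<close> the form is affine in \<open>c\<close>; this
      \<open>c\<close> gives it the value -1.\<close>
    then show False using assms(1)[of "(K + 1) / (2 * A)"] True by simp
  qed
  then show ?thesis using True by simp
next
  \<comment> \<open>\<open>A / V\<close> is the minimizer of the quadratic.\<close>
  case False
  then show ?thesis using assms(1)[of "A / V"] assms(2)
    by (simp add: power2_eq_square field_simps)
qed

text \<open>Cauchy-Schwarz applied to all indices at once, so that the sum of the variances appears
  as one factor. For each \<open>c\<close>, summing the nonnegative expectations of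
  \<open>(c * (b i - mean) - D i)^2\<close> gives a quadratic in \<open>c\<close>. As
  \<open>D i\<close> has mean 1, its cross term is the change of the mean of \<open>b i\<close>
  under the density \<open>D i\<close>.\<close>

lemma (in prob_space) change_of_expectation:
  fixes b D :: "'i \<Rightarrow> 'a \<Rightarrow> real"
  assumes b: "\<And>i. i \<in> I \<Longrightarrow> integrable M (b i)"
    and b2: "\<And>i. i \<in> I \<Longrightarrow> integrable M (\<lambda>y. (b i y)\<^sup>2)"
    and D: "\<And>i. i \<in> I \<Longrightarrow> has_bochner_integral M (D i) 1"
    and D2: "\<And>i. i \<in> I \<Longrightarrow> integrable M (\<lambda>y. (D i y)\<^sup>2)"
    and bD: "\<And>i. i \<in> I \<Longrightarrow> integrable M (\<lambda>y. D i y * b i y)"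
  shows "(\<Sum>i\<in>I. expectation (\<lambda>y. D i y * b i y) - expectation (b i))\<^sup>2 \<le>
    (\<Sum>i\<in>I. expectation (\<lambda>y. (b i y - expectation (b i))\<^sup>2)) * (\<Sum>i\<in>I. expectation (\<lambda>y. (D i y)\<^sup>2))"
proof (rule quadratic_form_discriminant)
  fix c :: real
  have "0 \<le> c\<^sup>2 * expectation (\<lambda>y. (b i y - expectation (b i))\<^sup>2)
      - 2 * c * (expectation (\<lambda>y. D i y * b i y) - expectation (b i)) + expectation (\<lambda>y. (D i y)\<^sup>2)"
    if "i \<in> I" for i
  proof -
    let ?\<mu> = "expectation (b i)"
    note [simp] = b[OF that] b2[OF that] D2[OF that] bD[OF that]
    have [simp]: "integrable M (D i)" "expectation (D i) = 1"
      using D[OF that] by (auto simp: has_bochner_integral_iff)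
    have v: "integrable M (\<lambda>y. (b i y - ?\<mu>)\<^sup>2)"
      by (simp add: power2_diff mult.assoc)
    have "0 \<le> expectation (\<lambda>y. (c * (b i y - ?\<mu>) - D i y)\<^sup>2)"
      by (rule integral_nonneg_AE) simp
    also have "(\<lambda>y. (c * (b i y - ?\<mu>) - D i y)\<^sup>2) =
        (\<lambda>y. c\<^sup>2 * (b i y - ?\<mu>)\<^sup>2 - 2 * c * (D i y * b i y - ?\<mu> * D i y) + (D i y)\<^sup>2)"
      by (rule ext) (simp add: power2_eq_square algebra_simps)
    also have "expectation \<dots> = c\<^sup>2 * expectation (\<lambda>y. (b i y - ?\<mu>)\<^sup>2)
        - 2 * c * (expectation (\<lambda>y. D i y * b i y) - ?\<mu>) + expectation (\<lambda>y. (D i y)\<^sup>2)"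
      using v by simp
    finally show ?thesis .
  qed
  from sum_nonneg[of I, OF this]
  show "0 \<le> c\<^sup>2 * (\<Sum>i\<in>I. expectation (\<lambda>y. (b i y - expectation (b i))\<^sup>2))
      - 2 * c * (\<Sum>i\<in>I. expectation (\<lambda>y. D i y * b i y) - expectation (b i))
      + (\<Sum>i\<in>I. expectation (\<lambda>y. (D i y)\<^sup>2))"
    by (simp add: sum.distrib sum_subtractf sum_distrib_left[symmetric])
qed (auto intro!: sum_nonneg integral_nonneg_AE)

lemma abs_sum_le_sqrt_card_L2_set:
  assumes "finite I" "J \<subseteq> I"
  shows "\<bar>\<Sum>i\<in>J. a i\<bar> \<le> sqrt (real (card J)) * L2_set a I"
proof -
  have "\<bar>\<Sum>i\<in>J. a i\<bar> \<le> (\<Sum>i\<in>J. \<bar>1\<bar> * \<bar>a i\<bar>)"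
    by simp
  also have "\<dots> \<le> L2_set (\<lambda>_. 1) J * L2_set a J"
    by (rule L2_set_mult_ineq)
  also have "\<dots> \<le> sqrt (real (card J)) * L2_set a I"
    using assms
    by (intro mult_mono) (auto simp: L2_set_def intro!: real_sqrt_le_mono sum_mono2 sum_nonneg)
  finally show ?thesis .
qed

section \<open>Blocks of coordinates and the spiked parameter vectors\<close>

text \<open>Block \<open>k\<close> consists of the indices from \<open>k * m\<close> to
  \<open>k * m + m - 1\<close>, and \<open>f k\<close> is an offset within it. Extensional functions
  make the set of choices finite and let sums over it factorize over the blocks.\<close>

definition block_choices :: "nat \<Rightarrow> nat \<Rightarrow> (nat \<Rightarrow> nat) set" where
  "block_choices s m = ({..<s} \<rightarrow>\<^sub>E {..<m})"

definition block_choices_at :: "nat \<Rightarrow> nat \<Rightarrow> nat \<Rightarrow> nat \<Rightarrow> (nat \<Rightarrow> nat) set" where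
  "block_choices_at s m k j = {f \<in> block_choices s m. f k = j}"

definition block_vec :: "nat \<Rightarrow> nat \<Rightarrow> nat \<Rightarrow> real \<Rightarrow> (nat \<Rightarrow> nat) \<Rightarrow> nat \<Rightarrow> real" where
  "block_vec p s m t f = (\<lambda>i\<in>{..<p}. if i \<in> (\<lambda>k. k * m + f k) ` {..<s} then t else 0)"

lemma finite_block_choices [simp]: "finite (block_choices s m)"
  by (simp add: block_choices_def finite_PiE)

lemma finite_block_choices_at [simp]: "finite (block_choices_at s m k j)"
  by (simp add: block_choices_at_def)

lemma block_choices_less: "f \<in> block_choices s m \<Longrightarrow> k < s \<Longrightarrow> f k < m"
  by (auto simp: block_choices_def)

text \<open>As a product set, in which only the factor at \<open>k\<close> is a singleton, the
  choices can be counted and sums of products over them become products of sums.\<close>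

lemma block_choices_at_eq_PiE:
  assumes "k < s" "j < m"
  shows "block_choices_at s m k j = PiE {..<s} (\<lambda>l. if l = k then {j} else {..<m})"
proof (intro set_eqI iffI)
  fix f assume "f \<in> block_choices_at s m k j"
  then show "f \<in> PiE {..<s} (\<lambda>l. if l = k then {j} else {..<m})"
    by (intro PiE_I) (auto simp: block_choices_at_def block_choices_def)
next
  fix f assume f: "f \<in> PiE {..<s} (\<lambda>l. if l = k then {j} else {..<m})"
  have "f k = j"
    using PiE_mem[OF f, of k] assms by simp
  moreover have "f l < m" if "l < s" for l
    using PiE_mem[OF f, of l] that assms by (cases "l = k") auto
  moreover have "f l = undefined" if "\<not> l < s" for l
    using PiE_arb[OF f, of l] that by simp
  ultimately show "f \<in> block_choices_at s m k j"
    by (auto simp: block_choices_at_def block_choices_def intro!: PiE_I)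
qed

lemma prod_if_one_index:
  fixes a b :: "'a::comm_monoid_mult"
  assumes "k < s"
  shows "(\<Prod>l<s. if l = k then a else b) = a * b ^ (s - 1)"
proof -
  have "(\<Prod>l<s. if l = k then a else b) = a * (\<Prod>l\<in>{..<s} - {k}. if l = k then a else b)"
    using assms by (subst prod.remove[of _ k]) auto
  also have "(\<Prod>l\<in>{..<s} - {k}. if l = k then a else b) = (\<Prod>l\<in>{..<s} - {k}. b)"
    by (intro prod.cong) auto
  finally show ?thesis using assms by simp
qed

lemma card_block_choices_at:
  assumes "k < s" "j < m"
  shows "card (block_choices_at s m k j) = m ^ (s - 1)"
proof -
  have "card (block_choices_at s m k j) = (\<Prod>l<s. card (if l = k then {j} else {..<m}))"
    by (simp only: block_choices_at_eq_PiE[OF assms] card_PiE finite_lessThan)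
  also have "\<dots> = (\<Prod>l<s. if l = k then 1 else m)"
    by (intro prod.cong) auto
  finally show ?thesis using prod_if_one_index[OF assms(1), of "1::nat" m] by simp
qed

text \<open>Uniqueness of quotient and remainder on division by \<open>m\<close>.\<close>

lemma block_index_eq_iff:
  fixes j j' m :: nat
  assumes "j < m" "j' < m"
  shows "k * m + j = k' * m + j' \<longleftrightarrow> k = k' \<and> j = j'"
proof
  assume *: "k * m + j = k' * m + j'"
  have "(k * m + j) div m = k" "(k' * m + j') div m = k'" using assms by auto
  with * have "k = k'" by simp
  with * show "k = k' \<and> j = j'" by simp
qed simp

lemma inj_on_block_index: "inj_on (\<lambda>(k, j). k * m + j) ({..<s} \<times> {..<m::nat})"
  by (auto simp: inj_on_def block_index_eq_iff)

lemma block_index_less: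
  fixes j m :: nat
  assumes "k < s" "j < m" "s * m \<le> p"
  shows "k * m + j < p"
proof -
  have "k * m + j < k * m + m" using assms by simp
  also have "\<dots> = Suc k * m" by simp
  also have "\<dots> \<le> s * m" using assms by (intro mult_le_mono1) simp
  finally show ?thesis using assms by simp
qed

lemma inj_on_block_choice:
  assumes "f \<in> block_choices s m"
  shows "inj_on (\<lambda>k. k * m + f k) {..<s}"
  using block_choices_less[OF assms] by (auto simp: inj_on_def block_index_eq_iff)

lemma block_vec_sparse: "block_vec p s m t f \<in> sparse_vecs p s"
proof -
  have "{i. i < p \<and> block_vec p s m t f i \<noteq> 0} \<subseteq> (\<lambda>k. k * m + f k) ` {..<s}"
    by (auto simp: block_vec_def)
  then have "card {i. i < p \<and> block_vec p s m t f i \<noteq> 0} \<le> card ((\<lambda>k. k * m + f k) ` {..<s})"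
    by (intro card_mono) auto
  also have "\<dots> \<le> s" using card_image_le[of "{..<s}"] by simp
  finally show ?thesis
    by (simp add: sparse_vecs_def space_PiM PiE_iff extensional_def block_vec_def)
qed

lemma zero_vec_sparse: "zero_vec p \<in> sparse_vecs p s"
proof -
  have "{i. i < p \<and> zero_vec p i \<noteq> 0} = {}" by (auto simp: zero_vec_def)
  then show ?thesis
    by (simp add: sparse_vecs_def space_PiM PiE_iff extensional_def zero_vec_def)
qed

lemma sum_mult_block_vec:
  assumes "f \<in> block_choices s m" "s * m \<le> p"
  shows "(\<Sum>i<p. h i * block_vec p s m t f i) = t * (\<Sum>k<s. h (k * m + f k))"
proof -
  let ?S = "(\<lambda>k. k * m + f k) ` {..<s}"
  have S: "?S \<subseteq> {..<p}"
    using block_index_less[OF _ block_choices_less[OF assms(1)] assms(2)] by auto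
  have "(\<Sum>i<p. h i * block_vec p s m t f i) = (\<Sum>i<p. if i \<in> ?S then h i * t else 0)"
    by (intro sum.cong) (auto simp: block_vec_def)
  also have "\<dots> = (\<Sum>i\<in>?S. h i * t)"
    using S by (simp add: sum.inter_restrict[symmetric] Int_absorb1)
  also have "\<dots> = t * (\<Sum>k<s. h (k * m + f k))"
    by (simp add: sum.reindex[OF inj_on_block_choice[OF assms(1)]] sum_distrib_left mult.commute)
  finally show ?thesis .
qed

section \<open>Coherence and the overlap of two choices\<close>

lemma gram_le_mutual_coherence:
  assumes "i < p" "j < p" "i \<noteq> j" "gram n X i i = real n" "n > 0" "mutual_coherence n p X \<le> c"
  shows "gram n X i j \<le> real n * c"
proof -
  let ?S = "{gram n X i j / gram n X i i | i j. i < p \<and> j < p \<and> i \<noteq> j}"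
  have "?S \<subseteq> (\<lambda>(i, j). gram n X i j / gram n X i i) ` ({..<p} \<times> {..<p})" by auto
  then have "finite ?S" by (rule finite_subset) auto
  then have "gram n X i j / gram n X i i \<le> mutual_coherence n p X"
    unfolding mutual_coherence_def by (rule Max_ge) (use assms in blast)
  then have "gram n X i j \<le> real n * mutual_coherence n p X"
    using assms by (simp add: field_simps)
  also have "\<dots> \<le> real n * c"
    using assms by (intro mult_left_mono) auto
  finally show ?thesis .
qed

text \<open>The inner product expands into one Gram entry for each pair of blocks. An entry is
  diagonal, with value \<open>n\<close>, exactly when the blocks are the same and \<open>f\<close>
  and \<open>g\<close> agree there; all others are at most \<open>n * c\<close>.\<close>

lemma inner_block_vec_le:
  assumes f: "f \<in> block_choices s m" and g: "g \<in> block_choices s m" and sm: "s * m \<le> p"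
    and diag: "\<forall>i<p. gram n X i i = real n" and n: "n > 0"
    and mc: "mutual_coherence n p X \<le> c" and c: "0 \<le> c"
  shows "(\<Sum>l<n. (\<Sum>j<p. X l j * block_vec p s m t f j) * (\<Sum>j<p. X l j * block_vec p s m t g j))
    \<le> t\<^sup>2 * real n * ((\<Sum>k<s. if f k = g k then 1 else 0) + (real s)\<^sup>2 * c)" (is "?l \<le> _")
proof -
  have "?l = (\<Sum>l<n. t\<^sup>2 * (\<Sum>k<s. \<Sum>k'<s. X l (k * m + f k) * X l (k' * m + g k')))"
    unfolding sum_mult_block_vec[OF f sm] sum_mult_block_vec[OF g sm] sum_product[symmetric]
    by (simp add: power2_eq_square mult.assoc mult.left_commute)
  also have "\<dots> = t\<^sup>2 * (\<Sum>k<s. \<Sum>k'<s. gram n X (k * m + f k) (k' * m + g k'))"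
  proof -
    have "(\<Sum>l<n. \<Sum>k<s. \<Sum>k'<s. X l (k * m + f k) * X l (k' * m + g k')) =
        (\<Sum>k<s. \<Sum>l<n. \<Sum>k'<s. X l (k * m + f k) * X l (k' * m + g k'))"
      by (rule sum.swap)
    also have "\<dots> = (\<Sum>k<s. \<Sum>k'<s. gram n X (k * m + f k) (k' * m + g k'))"
      unfolding gram_def by (intro sum.cong refl sum.swap)
    finally show ?thesis by (simp add: sum_distrib_left[symmetric])
  qed
  \<comment> \<open>The term \<open>c\<close> is added to the diagonal entries as well, so that it
    occurs once for each of the \<open>s * s\<close> pairs.\<close>
  also have "\<dots> \<le> t\<^sup>2 * (\<Sum>k<s. \<Sum>k'<s. real n * ((if k' = k then (if f k = g k then 1 else 0) else 0) + c))"
  proof (intro mult_left_mono sum_mono)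
    fix k k' assume k: "k \<in> {..<s}" "k' \<in> {..<s}"
    have less: "f k < m" "g k' < m"
      using k block_choices_less[OF f] block_choices_less[OF g] by auto
    have lp: "k * m + f k < p" "k' * m + g k' < p"
      using k less sm by (auto intro: block_index_less)
    show "gram n X (k * m + f k) (k' * m + g k') \<le>
        real n * ((if k' = k then (if f k = g k then 1 else 0) else 0) + c)"
    proof (cases "k = k' \<and> f k = g k'")
      case True
      then show ?thesis using lp diag c by (auto simp: field_simps)
    next
      case False
      then have "gram n X (k * m + f k) (k' * m + g k') \<le> real n * c"
        using lp diag n mc less
        by (intro gram_le_mutual_coherence[where p=p]) (auto simp: block_index_eq_iff)
      then show ?thesis using False by auto
    qed
  qed simp
  also have "\<dots> = t\<^sup>2 * real n * ((\<Sum>k<s. if f k = g k then 1 else 0) + (real s)\<^sup>2 * c)"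
    by (simp add: sum_distrib_left[symmetric] sum.distrib power2_eq_square algebra_simps)
  finally show ?thesis .
qed

text \<open>For fixed \<open>f\<close> the sum over \<open>g\<close> factorizes over the blocks. In
  block \<open>k\<close> both choices are forced to agree, which gives \<open>q\<close>. In any
  other block one of the \<open>m\<close> positions gives \<open>q\<close> and the rest give 1,
  hence at most \<open>m + q\<close>.\<close>

lemma sum_overlap_le:
  fixes q :: real
  assumes kj: "k < s" "j < m" and q: "0 \<le> q"
  shows "(\<Sum>f\<in>block_choices_at s m k j. \<Sum>g\<in>block_choices_at s m k j.
            \<Prod>l<s. if f l = g l then q else 1)
    \<le> (real m ^ (s - 1))\<^sup>2 * (q * (1 + q / real m) ^ (s - 1))"
proof -
  let ?C = "block_choices_at s m k j"
  let ?B = "\<lambda>l. if l = k then {j} else {..<m}"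
  have "(\<Sum>g\<in>?C. \<Prod>l<s. if f l = g l then q else 1) \<le> q * (real m + q) ^ (s - 1)"
    if f: "f \<in> ?C" for f
  proof -
    have "(\<Sum>g\<in>?C. \<Prod>l<s. if f l = g l then q else 1) =
        (\<Prod>l<s. \<Sum>i\<in>?B l. if f l = i then q else 1)"
      unfolding block_choices_at_eq_PiE[OF kj] by (rule prod_sum_PiE[symmetric]) auto
    also have "\<dots> \<le> (\<Prod>l<s. if l = k then q else real m + q)"
    proof (rule prod_mono)
      fix l assume "l \<in> {..<s}"
      have "(\<Sum>i<m. if f l = i then q else 1) \<le> (\<Sum>i<m. 1 + (if f l = i then q else 0))"
        using q by (intro sum_mono) auto
      also have "\<dots> \<le> real m + q"
        using q by (simp add: sum.distrib)
      finally show "0 \<le> (\<Sum>i\<in>?B l. if f l = i then q else 1) \<and>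
          (\<Sum>i\<in>?B l. if f l = i then q else 1) \<le> (if l = k then q else real m + q)"
        using f q by (auto simp: block_choices_at_def intro!: sum_nonneg)
    qed
    also have "\<dots> = q * (real m + q) ^ (s - 1)"
      by (rule prod_if_one_index) fact
    finally show ?thesis .
  qed
  then have "(\<Sum>f\<in>?C. \<Sum>g\<in>?C. \<Prod>l<s. if f l = g l then q else 1)
      \<le> real (card ?C) * (q * (real m + q) ^ (s - 1))"
    by (rule sum_bounded_above)
  also have "real m + q = real m * (1 + q / real m)"
    using kj by (simp add: field_simps)
  finally show ?thesis
    by (simp add: card_block_choices_at[OF kj] power_mult_distrib power2_eq_square ac_simps)
qed

section \<open>The shift of the mean forced by the bias bound\<close>

text \<open>Each choice \<open>f\<close> selects exactly one position in block \<open>k\<close>, so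
  for fixed \<open>k\<close> the sets \<open>block_choices_at s m k j\<close> partition all choices
  by the value \<open>j\<close> of \<open>f k\<close>.\<close>

lemma sum_block_choices_at:
  fixes h :: "(nat \<Rightarrow> nat) \<Rightarrow> nat \<Rightarrow> real"
  shows "(\<Sum>(k, j)\<in>{..<s} \<times> {..<m}. \<Sum>f\<in>block_choices_at s m k j. h f (k * m + j)) =
    (\<Sum>f\<in>block_choices s m. \<Sum>k<s. h f (k * m + f k))"
proof -
  have "(\<Sum>j<m. \<Sum>f\<in>block_choices_at s m k j. h f (k * m + j)) =
      (\<Sum>f\<in>block_choices s m. h f (k * m + f k))" if "k < s" for k
  proof -
    have "(\<Sum>j<m. \<Sum>f\<in>block_choices_at s m k j. h f (k * m + j)) =
        (\<Sum>j<m. \<Sum>f\<in>block_choices_at s m k j. h f (k * m + f k))"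
      by (intro sum.cong) (auto simp: block_choices_at_def)
    also have "\<dots> = (\<Sum>f\<in>block_choices s m. h f (k * m + f k))"
      unfolding block_choices_at_def
      by (rule sum.group) (use block_choices_less[OF _ that] in auto)
    finally show ?thesis .
  qed
  then show ?thesis
    by (simp add: sum.cartesian_product[symmetric]) (rule sum.swap)
qed

text \<open>The budget for the spike height, in units of \<open>1 / sqrt n\<close>. The bias costs
  \<open>sqrt x\<close> at the spiked vectors and at most half of that at zero; a shift of 1/2 must
  remain. The factor 4 here later becomes the exponent \<open>4 * \<gamma>\<close>.\<close>

lemma sqrt_four_mult_add_one_ge:
  fixes x :: real
  assumes "0 \<le> x"
  shows "1 / 2 + 3 / 2 * sqrt x \<le> sqrt (4 * x + 1)"
proof (rule real_le_rsqrt)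
  have "4 * x + 1 - (1 / 2 + 3 / 2 * sqrt x)\<^sup>2 = 7 / 4 * (sqrt x - 3 / 7)\<^sup>2 + 3 / 7"
    using assms by (simp add: power2_diff power2_sum power_mult_distrib power_divide) (simp add: field_simps)
  moreover have "0 \<le> 7 / 4 * (sqrt x - 3 / 7)\<^sup>2"
    by simp
  ultimately show "(1 / 2 + 3 / 2 * sqrt x)\<^sup>2 \<le> 4 * x + 1"
    by linarith
qed

text \<open>\<open>E \<beta> i\<close> stands for the mean of the \<open>i\<close>-th component
  under \<open>\<beta>\<close>. At a spiked vector the bias bound makes the sum of the means over
  the spikes large; at zero it makes the sum over all blocks small. Averaging the first bound over
  all choices and regrouping by coordinate yields the difference.\<close>

lemma block_mean_shift:
  fixes E :: "(nat \<Rightarrow> real) \<Rightarrow> nat \<Rightarrow> real"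
  assumes sm: "s * m \<le> p" and m: "4 \<le> m" and x: "0 \<le> x" and n: "0 < n"
    and bias: "\<And>\<beta>. \<beta> \<in> sparse_vecs p s \<Longrightarrow>
      (L2_set (\<lambda>i. E \<beta> i - \<beta> i) {..<p})\<^sup>2 \<le> real s * (x / real n)"
    and t: "t = sqrt ((4 * x + 1) / real n)"
  shows "real s * real m / (2 * sqrt (real n)) \<le>
    (\<Sum>(k, j)\<in>{..<s} \<times> {..<m}.
       (\<Sum>f\<in>block_choices_at s m k j. E (block_vec p s m t f) (k * m + j)) / real m ^ (s - 1)
         - E (zero_vec p) (k * m + j))"
proof -
  let ?e = "\<lambda>(k, j). k * m + j"
  let ?I = "{..<s} \<times> {..<m}"
  have mp: "0 < real m" using m by simp
  have L2: "L2_set (\<lambda>i. E \<beta> i - \<beta> i) {..<p} \<le> sqrt (real s * (x / real n))"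
    if "\<beta> \<in> sparse_vecs p s" for \<beta>
    using bias[OF that] by (rule real_le_rsqrt)
  have spike: "real s * (t - sqrt (x / real n)) \<le> (\<Sum>k<s. E (block_vec p s m t f) (k * m + f k))"
    if f: "f \<in> block_choices s m" for f
  proof -
    let ?\<beta> = "block_vec p s m t f"
    let ?S = "(\<lambda>k. k * m + f k) ` {..<s}"
    have S: "?S \<subseteq> {..<p}"
      using block_index_less[OF _ block_choices_less[OF f] sm] by auto
    have cS: "card ?S = s" using card_image[OF inj_on_block_choice[OF f]] by simp
    have "\<bar>\<Sum>i\<in>?S. E ?\<beta> i - ?\<beta> i\<bar> \<le> sqrt (real s) * L2_set (\<lambda>i. E ?\<beta> i - ?\<beta> i) {..<p}"
      using abs_sum_le_sqrt_card_L2_set[OF _ S] cS by simp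
    also have "\<dots> \<le> sqrt (real s) * sqrt (real s * (x / real n))"
      by (intro mult_left_mono L2 block_vec_sparse) simp
    also have "\<dots> = real s * sqrt (x / real n)"
      by (simp only: real_sqrt_mult mult.assoc[symmetric] real_sqrt_mult_self abs_of_nat)
    finally have "\<bar>\<Sum>i\<in>?S. E ?\<beta> i - ?\<beta> i\<bar> \<le> real s * sqrt (x / real n)" .
    moreover have "(\<Sum>i\<in>?S. E ?\<beta> i - ?\<beta> i) = (\<Sum>k<s. E ?\<beta> (k * m + f k)) - real s * t"
    proof -
      have "(\<Sum>i\<in>?S. E ?\<beta> i - ?\<beta> i) = (\<Sum>i\<in>?S. E ?\<beta> i - t)"
        using S by (intro sum.cong) (auto simp: block_vec_def)
      also have "\<dots> = (\<Sum>k<s. E ?\<beta> (k * m + f k) - t)"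
        by (subst sum.reindex[OF inj_on_block_choice[OF f]]) simp
      finally show ?thesis by (simp add: sum_subtractf)
    qed
    ultimately show ?thesis by (simp add: algebra_simps)
  qed
  have zero: "(\<Sum>(k, j)\<in>?I. E (zero_vec p) (k * m + j)) \<le> real s * real m / 2 * sqrt (x / real n)"
  proof -
    have J: "?e ` ?I \<subseteq> {..<p}"
      using block_index_less[OF _ _ sm] by auto
    have cJ: "card (?e ` ?I) = s * m"
      using card_image[OF inj_on_block_index] by simp
    have "(\<Sum>(k, j)\<in>?I. E (zero_vec p) (k * m + j)) = (\<Sum>i\<in>?e ` ?I. E (zero_vec p) i)"
      by (subst sum.reindex[OF inj_on_block_index]) (simp add: case_prod_unfold)
    also have "\<dots> = (\<Sum>i\<in>?e ` ?I. E (zero_vec p) i - zero_vec p i)"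
      using J by (intro sum.cong) (auto simp: zero_vec_def)
    also have "\<dots> \<le> sqrt (real (s * m)) * L2_set (\<lambda>i. E (zero_vec p) i - zero_vec p i) {..<p}"
      using abs_sum_le_sqrt_card_L2_set[OF _ J, of "\<lambda>i. E (zero_vec p) i - zero_vec p i"] cJ by simp
    also have "\<dots> \<le> sqrt (real (s * m)) * sqrt (real s * (x / real n))"
      by (intro mult_left_mono L2 zero_vec_sparse) simp
    also have "\<dots> = real s * sqrt (real m) * sqrt (x / real n)"
      by (simp add: real_sqrt_mult real_sqrt_divide)
    also have "\<dots> \<le> real s * (real m / 2) * sqrt (x / real n)"
    proof (intro mult_left_mono mult_right_mono)
      \<comment> \<open>Blocks of size at least 4 make the cost at zero only half of
        \<open>sqrt x\<close> for each coordinate.\<close>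
      have "4 * real m \<le> real m * real m" using m by (intro mult_right_mono) auto
      then show "sqrt (real m) \<le> real m / 2"
        by (intro real_le_lsqrt) (auto simp: power2_eq_square)
    qed (use x in auto)
    finally show ?thesis by simp
  qed
  have avg: "real s * real m * (t - sqrt (x / real n)) \<le>
      (\<Sum>(k, j)\<in>?I. (\<Sum>f\<in>block_choices_at s m k j. E (block_vec p s m t f) (k * m + j))) / real m ^ (s - 1)"
  \<comment> \<open>For \<open>s > 0\<close> the number of all choices is
    \<open>m * m ^ (s - 1)\<close>; for \<open>s = 0\<close> the exponent is truncated, but both
    sides vanish.\<close>
  proof (cases s)
    case (Suc s')
    have "real s * real m * (t - sqrt (x / real n)) * real m ^ (s - 1) =
        real (card (block_choices s m)) * (real s * (t - sqrt (x / real n)))"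
      by (simp add: Suc block_choices_def card_PiE)
    also have "\<dots> \<le> (\<Sum>f\<in>block_choices s m. \<Sum>k<s. E (block_vec p s m t f) (k * m + f k))"
      using spike by (intro sum_bounded_below) auto
    also have "\<dots> = (\<Sum>(k, j)\<in>?I. \<Sum>f\<in>block_choices_at s m k j. E (block_vec p s m t f) (k * m + j))"
      by (rule sum_block_choices_at[symmetric])
    finally show ?thesis using mp by (simp add: pos_le_divide_eq)
  qed simp
  have "real s * real m / (2 * sqrt (real n)) = real s * real m * ((1 / 2) / sqrt (real n))"
    by simp
  also have "\<dots> \<le> real s * real m * ((sqrt (4 * x + 1) - 3 / 2 * sqrt x) / sqrt (real n))"
    using sqrt_four_mult_add_one_ge[OF x]
    by (intro mult_left_mono divide_right_mono) auto
  also have "\<dots> = real s * real m * (t - sqrt (x / real n)) - real s * real m / 2 * sqrt (x / real n)"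
    unfolding t real_sqrt_divide by (simp add: diff_divide_distrib algebra_simps)
  also have "\<dots> \<le> (\<Sum>(k, j)\<in>?I. (\<Sum>f\<in>block_choices_at s m k j. E (block_vec p s m t f) (k * m + j))) / real m ^ (s - 1)
      - (\<Sum>(k, j)\<in>?I. E (zero_vec p) (k * m + j))"
    using avg zero by linarith
  finally show ?thesis
    by (simp add: case_prod_unfold sum_subtractf sum_divide_distrib)
qed

section \<open>The mixture density and the variance bound\<close>

text \<open>The density with respect to P0 of the uniform mixture of the laws whose spike in block
  \<open>k\<close> sits at offset \<open>j\<close>. The divisor is the number of such choices when
  \<open>k < s\<close> and \<open>j < m\<close>.\<close>

definition block_density ::
    "nat \<Rightarrow> nat \<Rightarrow> (nat \<Rightarrow> nat \<Rightarrow> real) \<Rightarrow> nat \<Rightarrow> nat \<Rightarrow> real \<Rightarrow> nat \<Rightarrow> nat \<Rightarrow> (nat \<Rightarrow> real) \<Rightarrow> real" where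
  "block_density n p X s m t k j y =
     (\<Sum>f\<in>block_choices_at s m k j.
        gaussian_tilt n (\<lambda>l. \<Sum>i<p. X l i * block_vec p s m t f i) y) / real m ^ (s - 1)"

lemma has_bochner_integral_block_density:
  assumes "k < s" "j < m"
  shows "has_bochner_integral (std_gaussian_vec n) (block_density n p X s m t k j) 1"
proof -
  have "has_bochner_integral (std_gaussian_vec n) (block_density n p X s m t k j)
     ((\<Sum>f\<in>block_choices_at s m k j. 1) / real m ^ (s - 1))"
    unfolding block_density_def
    by (intro has_bochner_integral_divide has_bochner_integral_sum has_bochner_integral_gaussian_tilt)
  then show ?thesis using assms by (simp add: card_block_choices_at)
qed

text \<open>The square of the mixture is a double sum over \<open>f\<close> and \<open>g\<close>,
  and each term integrates to \<open>exp\<close> of an inner product. Each agreeing block costs a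
  factor \<open>exp a\<close>, the coherence a common factor \<open>exp (a * s^2 * c)\<close>, and
  the overlap count bounds the rest.\<close>

lemma block_density_second_moment:
  assumes kj: "k < s" "j < m" and sm: "s * m \<le> p"
    and diag: "\<forall>i<p. gram n X i i = real n" and n: "n > 0"
    and mc: "mutual_coherence n p X \<le> c" and c: "0 \<le> c"
    and t: "t\<^sup>2 * real n = a"
  shows "integrable (std_gaussian_vec n) (\<lambda>y. (block_density n p X s m t k j y)\<^sup>2)" (is ?int)
    and "(\<integral>y. (block_density n p X s m t k j y)\<^sup>2 \<partial>std_gaussian_vec n)
      \<le> exp (a * (real s)\<^sup>2 * c) * (exp a * (1 + exp a / real m) ^ (s - 1))" (is "?I \<le> _")
proof -
  let ?C = "block_choices_at s m k j"
  let ?v = "\<lambda>f l. \<Sum>i<p. X l i * block_vec p s m t f i"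
  let ?M = "(real m ^ (s - 1))\<^sup>2"
  have M: "0 < ?M" using kj by simp
  have "has_bochner_integral (std_gaussian_vec n)
      (\<lambda>y. (\<Sum>f\<in>?C. \<Sum>g\<in>?C. gaussian_tilt n (?v f) y * gaussian_tilt n (?v g) y) / ?M)
      ((\<Sum>f\<in>?C. \<Sum>g\<in>?C. exp (\<Sum>l<n. ?v f l * ?v g l)) / ?M)"
    by (intro has_bochner_integral_divide has_bochner_integral_sum
        has_bochner_integral_gaussian_tilt_mult)
  also have "(\<lambda>y. (\<Sum>f\<in>?C. \<Sum>g\<in>?C. gaussian_tilt n (?v f) y * gaussian_tilt n (?v g) y) / ?M) =
      (\<lambda>y. (block_density n p X s m t k j y)\<^sup>2)"
    by (simp add: block_density_def power_divide power2_eq_square sum_product)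
  finally have D2: "has_bochner_integral (std_gaussian_vec n) (\<lambda>y. (block_density n p X s m t k j y)\<^sup>2)
      ((\<Sum>f\<in>?C. \<Sum>g\<in>?C. exp (\<Sum>l<n. ?v f l * ?v g l)) / ?M)" .
  then show ?int by (simp add: has_bochner_integral_iff)
  have "(\<Sum>f\<in>?C. \<Sum>g\<in>?C. exp (\<Sum>l<n. ?v f l * ?v g l)) \<le>
      (\<Sum>f\<in>?C. \<Sum>g\<in>?C. exp (a * (real s)\<^sup>2 * c) * (\<Prod>l<s. if f l = g l then exp a else 1))"
  proof (intro sum_mono)
    fix f g assume fg: "f \<in> ?C" "g \<in> ?C"
    have "(\<Sum>l<n. ?v f l * ?v g l) \<le>
        t\<^sup>2 * real n * ((\<Sum>k<s. if f k = g k then 1 else 0) + (real s)\<^sup>2 * c)"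
      using fg by (intro inner_block_vec_le[OF _ _ sm diag n mc c]) (auto simp: block_choices_at_def)
    then have "exp (\<Sum>l<n. ?v f l * ?v g l) \<le>
        exp (a * (real s)\<^sup>2 * c + (\<Sum>k<s. a * (if f k = g k then 1 else 0)))"
      unfolding t by (simp add: sum_distrib_left[symmetric] algebra_simps)
    also have "\<dots> = exp (a * (real s)\<^sup>2 * c) * (\<Prod>l<s. if f l = g l then exp a else 1)"
      unfolding exp_add by (auto simp: exp_sum intro!: prod.cong)
    finally show "exp (\<Sum>l<n. ?v f l * ?v g l) \<le>
        exp (a * (real s)\<^sup>2 * c) * (\<Prod>l<s. if f l = g l then exp a else 1)" .
  qed
  also have "\<dots> \<le> exp (a * (real s)\<^sup>2 * c) * (?M * (exp a * (1 + exp a / real m) ^ (s - 1)))"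
    unfolding sum_distrib_left[symmetric]
    by (intro mult_left_mono sum_overlap_le kj) auto
  finally show "?I \<le> exp (a * (real s)\<^sup>2 * c) * (exp a * (1 + exp a / real m) ^ (s - 1))"
    using D2 M by (simp add: has_bochner_integral_iff pos_divide_le_eq ac_simps)
qed

text \<open>With \<open>N = s * m\<close> coordinates in the blocks, the total mean shift
  \<open>A\<close> is at least \<open>N / (2 * sqrt n)\<close>, while Cauchy-Schwarz gives
  \<open>A^2 \<le> V * N * K\<close>. One factor \<open>N\<close> cancels.\<close>

lemma block_variance_bound:
  fixes n :: nat and X :: "nat \<Rightarrow> nat \<Rightarrow> real" and b :: "(nat \<Rightarrow> real) \<Rightarrow> nat \<Rightarrow> real"
  defines "M \<equiv> std_gaussian_vec n"
  assumes sm: "s * m \<le> p" and m: "4 \<le> m" and s: "0 < s" and x: "0 \<le> x" and n: "0 < n"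
    and est: "is_estimator n p X s b"
    and sq: "\<And>i. i < p \<Longrightarrow> integrable M (\<lambda>y. (b y i)\<^sup>2)"
    and bias: "\<And>\<beta>. \<beta> \<in> sparse_vecs p s \<Longrightarrow>
      (L2_set (\<lambda>i. (\<integral>y. b y i \<partial>regression_law n p X \<beta>) - \<beta> i) {..<p})\<^sup>2 \<le> real s * (x / real n)"
    and diag: "\<forall>i<p. gram n X i i = real n"
    and mc: "mutual_coherence n p X \<le> c" and c: "0 \<le> c"
    and K: "exp ((4 * x + 1) * (real s)\<^sup>2 * c) *
      (exp (4 * x + 1) * (1 + exp (4 * x + 1) / real m) ^ (s - 1)) \<le> K"
  shows "real s * real m / (4 * real n * K) \<le> (\<Sum>i<p. \<integral>y. (b y i - (\<integral>z. b z i \<partial>M))\<^sup>2 \<partial>M)"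
proof -
  interpret prob_space M unfolding M_def by (rule prob_space_std_gaussian_vec)
  let ?I = "{..<s} \<times> {..<m}"
  let ?e = "\<lambda>(k, j). k * m + j"
  define a where "a = 4 * x + 1"
  define t where "t = sqrt (a / real n)"
  have ta: "t\<^sup>2 * real n = a" using x n by (simp add: t_def a_def)
  let ?E = "\<lambda>\<beta> i. \<integral>y. b y i \<partial>regression_law n p X \<beta>"
  let ?v = "\<lambda>f l. \<Sum>i<p. X l i * block_vec p s m t f i"
  define D where "D = (\<lambda>(k, j). block_density n p X s m t k j)"
  have ep: "?e z < p" if "z \<in> ?I" for z
    using that block_index_less[OF _ _ sm] by auto
  have bm: "(\<lambda>y. b y i) \<in> borel_measurable (borel_vec n)" if "i < p" for i
    using est that unfolding is_estimator_def
    by (auto intro: measurable_compose[OF _ measurable_component_singleton])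
  have bint: "integrable (regression_law n p X \<beta>) (\<lambda>y. b y i)" if "\<beta> \<in> sparse_vecs p s" "i < p" for \<beta> i
    using est that unfolding is_estimator_def by blast
  have M0: "M = regression_law n p X (zero_vec p)"
    by (simp add: M_def regression_law_zero)
  \<comment> \<open>The mean under the mixture is the average of the means under the individual
    spiked laws.\<close>
  have Db: "has_bochner_integral M (\<lambda>y. D z y * b y (?e z))
      ((\<Sum>f\<in>block_choices_at s m (fst z) (snd z). ?E (block_vec p s m t f) (?e z)) / real m ^ (s - 1))"
    if z: "z \<in> ?I" for z
  proof -
    have "has_bochner_integral M (\<lambda>y. gaussian_tilt n (?v f) y * b y (?e z)) (?E (block_vec p s m t f) (?e z))" for f
      using bint[OF block_vec_sparse ep[OF z]]
      unfolding M_def has_bochner_integral_iff regression_law_integral[OF bm[OF ep[OF z]]] by simp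
    then have "has_bochner_integral M
        (\<lambda>y. (\<Sum>f\<in>block_choices_at s m (fst z) (snd z). gaussian_tilt n (?v f) y * b y (?e z)) / real m ^ (s - 1))
        ((\<Sum>f\<in>block_choices_at s m (fst z) (snd z). ?E (block_vec p s m t f) (?e z)) / real m ^ (s - 1))"
      by (intro has_bochner_integral_divide has_bochner_integral_sum)
    then show ?thesis
      by (simp add: D_def case_prod_unfold block_density_def sum_distrib_right)
  qed
  define A where "A = (\<Sum>z\<in>?I. expectation (\<lambda>y. D z y * b y (?e z)) - expectation (\<lambda>y. b y (?e z)))"
  define V where "V = (\<Sum>z\<in>?I. expectation (\<lambda>y. (b y (?e z) - expectation (\<lambda>y. b y (?e z)))\<^sup>2))"
  have "real s * real m / (2 * sqrt (real n)) \<le>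
    (\<Sum>(k, j)\<in>?I. (\<Sum>f\<in>block_choices_at s m k j. ?E (block_vec p s m t f) (k * m + j)) / real m ^ (s - 1)
         - ?E (zero_vec p) (k * m + j))"
    by (rule block_mean_shift[OF sm m x n bias]) (auto simp: t_def a_def)
  also have "\<dots> = A"
    unfolding A_def
    by (intro sum.cong refl)
      (use Db in \<open>auto simp: has_bochner_integral_iff M0[symmetric] split_beta\<close>)
  finally have A: "real s * real m / (2 * sqrt (real n)) \<le> A" .
  have D2: "integrable M (\<lambda>y. (D z y)\<^sup>2)" "expectation (\<lambda>y. (D z y)\<^sup>2) \<le> K" if "z \<in> ?I" for z
  proof -
    obtain k j where z: "z = (k, j)" "k < s" "j < m" using \<open>z \<in> ?I\<close> by auto
    show "integrable M (\<lambda>y. (D z y)\<^sup>2)" "expectation (\<lambda>y. (D z y)\<^sup>2) \<le> K"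
      using block_density_second_moment[OF z(2,3) sm diag n mc c ta] K
      by (simp_all add: z(1) D_def M_def a_def)
  qed
  have "A\<^sup>2 \<le> V * (\<Sum>z\<in>?I. expectation (\<lambda>y. (D z y)\<^sup>2))"
    unfolding A_def V_def
  proof (rule change_of_expectation)
    fix z assume z: "z \<in> ?I"
    show "integrable M (\<lambda>y. b y (?e z))"
      unfolding M0 by (rule bint[OF zero_vec_sparse ep[OF z]])
    show "integrable M (\<lambda>y. (b y (?e z))\<^sup>2)" by (rule sq[OF ep[OF z]])
    show "has_bochner_integral M (D z) 1"
      using z by (auto simp: D_def M_def intro: has_bochner_integral_block_density)
    show "integrable M (\<lambda>y. (D z y)\<^sup>2)" by (rule D2[OF z])
    show "integrable M (\<lambda>y. D z y * b y (?e z))"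
      using Db[OF z] by (simp add: has_bochner_integral_iff)
  qed
  also have "\<dots> \<le> V * (real (card ?I) * K)"
    by (intro mult_left_mono sum_bounded_above D2)
      (auto simp: V_def intro!: sum_nonneg integral_nonneg_AE)
  finally have AV: "A\<^sup>2 \<le> V * (real s * real m * K)" by simp
  have K0: "0 < K"
  proof -
    have "0 < exp ((4 * x + 1) * (real s)\<^sup>2 * c) *
        (exp (4 * x + 1) * (1 + exp (4 * x + 1) / real m) ^ (s - 1))"
      by (intro mult_pos_pos zero_less_power add_pos_nonneg) auto
    then show ?thesis using K by linarith
  qed
  define N where "N = real s * real m"
  have N0: "0 < N" using s m by (simp add: N_def)
  have "(N / (2 * sqrt (real n)))\<^sup>2 \<le> A\<^sup>2"
    using A N0 by (intro power_mono) (auto simp: N_def)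
  also have "(N / (2 * sqrt (real n)))\<^sup>2 = N * (N / (4 * real n))"
    by (simp add: power_divide power_mult_distrib) (simp add: power2_eq_square)
  also note AV
  finally have "N * (N / (4 * real n)) \<le> N * (V * K)"
    by (simp add: N_def ac_simps)
  then have "N / (4 * real n) \<le> V * K"
    using N0 by (simp only: mult_le_cancel_left_pos)
  then have "N / (4 * real n * K) \<le> V"
    unfolding divide_divide_eq_left[symmetric] pos_divide_le_eq[OF K0] .
  also have "V = (\<Sum>i\<in>?e ` ?I. \<integral>y. (b y i - (\<integral>z. b z i \<partial>M))\<^sup>2 \<partial>M)"
    unfolding V_def by (subst sum.reindex[OF inj_on_block_index]) simp
  \<comment> \<open>The coordinates outside the blocks only add nonnegative variances.\<close>
  also have "\<dots> \<le> (\<Sum>i<p. \<integral>y. (b y i - (\<integral>z. b z i \<partial>M))\<^sup>2 \<partial>M)"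
    using ep by (intro sum_mono2) (auto intro!: integral_nonneg_AE)
  finally show ?thesis by (simp add: N_def)
qed

section \<open>The choice of the blocks and the numerical constants\<close>

theorem theorem6p7:
  "\<exists>p0::nat. \<forall>(n::nat) (p::nat) (s::nat) (X :: nat \<Rightarrow> nat \<Rightarrow> real)
      (b :: (nat \<Rightarrow> real) \<Rightarrow> nat \<Rightarrow> real) (\<gamma>::real).
     p \<ge> p0 \<longrightarrow>
     n > 0 \<longrightarrow>
     (\<forall>i<p. gram n X i i = real n) \<longrightarrow>
     0 < s \<longrightarrow> real s \<le> sqrt (real p) / 2 \<longrightarrow>
     mutual_coherence n p X \<le> 1 / ((real s)\<^sup>2 * ln (real p / (real s)\<^sup>2)) \<longrightarrow>
     is_estimator n p X s b \<longrightarrow>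
     4 * \<gamma> + 1 / ln (real p / (real s)\<^sup>2) \<le> 0.99 \<longrightarrow>
     (SUP \<beta>\<in>sparse_vecs p s.
        ereal ((L2_set (\<lambda>i. (\<integral>y. b y i \<partial>regression_law n p X \<beta>) - \<beta> i) {..<p})\<^sup>2))
       \<le> ereal (\<gamma> * real s / real n * ln (real p / (real s)\<^sup>2)) \<longrightarrow>
     (\<Sum>i<p. ext_variance (regression_law n p X (zero_vec p)) (\<lambda>y. b y i))
       \<ge> ennreal ((1 - (1/2) powr 0.01) / (25 * (exp 1)\<^sup>2 * ln (real p / (real s)\<^sup>2))
            * (real p / real n) * ((real s)\<^sup>2 / real p) powr (4 * \<gamma>))"
\<comment> \<open>The threshold 0 works because \<open>0 < s\<close> and
  \<open>s \<le> sqrt p / 2\<close> already force \<open>p \<ge> 4\<close>.\<close>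
proof (intro exI[of _ 0] allI impI)
  fix n p s :: nat and X :: "nat \<Rightarrow> nat \<Rightarrow> real" and b :: "(nat \<Rightarrow> real) \<Rightarrow> nat \<Rightarrow> real" and \<gamma> :: real
  assume n: "n > 0" and diag: "\<forall>i<p. gram n X i i = real n" and s: "0 < s"
    and sp: "real s \<le> sqrt (real p) / 2"
    and mc: "mutual_coherence n p X \<le> 1 / ((real s)\<^sup>2 * ln (real p / (real s)\<^sup>2))"
    and est: "is_estimator n p X s b"
    and \<gamma>: "4 * \<gamma> + 1 / ln (real p / (real s)\<^sup>2) \<le> 0.99"
    and sup: "(SUP \<beta>\<in>sparse_vecs p s.
        ereal ((L2_set (\<lambda>i. (\<integral>y. b y i \<partial>regression_law n p X \<beta>) - \<beta> i) {..<p})\<^sup>2))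
       \<le> ereal (\<gamma> * real s / real n * ln (real p / (real s)\<^sup>2))"
  define L where "L = ln (real p / (real s)\<^sup>2)"
  define x where "x = \<gamma> * L"
  define r where "r = exp (4 * x)"
  define m where "m = p div s"
  have p4: "4 * (real s)\<^sup>2 \<le> real p"
  proof -
    have "(2 * real s)\<^sup>2 \<le> (sqrt (real p))\<^sup>2"
      using sp by (intro power_mono) auto
    then show ?thesis by (simp add: power_mult_distrib)
  qed
  then have "real (4 * s * s) \<le> real p" by (simp add: power2_eq_square)
  then have p4n: "4 * s * s \<le> p" by (simp only: of_nat_le_iff)
  have R: "4 \<le> real p / (real s)\<^sup>2"
    using p4 s by (simp add: pos_le_divide_eq)
  have L0: "0 < L" unfolding L_def using R by (intro ln_gt_zero) linarith
  have bias: "(L2_set (\<lambda>i. (\<integral>y. b y i \<partial>regression_law n p X \<beta>) - \<beta> i) {..<p})\<^sup>2 \<le> real s * (x / real n)"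
    if "\<beta> \<in> sparse_vecs p s" for \<beta>
    using order_trans[OF SUP_upper[OF that] sup] by (simp add: x_def L_def mult_ac)
  \<comment> \<open>The sign of \<open>\<gamma>\<close> comes from the bias bound at the zero
    vector, whose left side is a square.\<close>
  have "0 \<le> real s * (x / real n)"
    using bias[OF zero_vec_sparse] by (rule order_trans[OF zero_le_power2])
  then have x0: "0 \<le> x"
    using s n by (simp add: zero_le_mult_iff zero_le_divide_iff)
  then have "0 \<le> \<gamma>" using L0 by (simp add: x_def zero_le_mult_iff)
  then have "1 / L \<le> 1" using \<gamma> by (simp add: L_def)
  then have L1: "1 \<le> L" using L0 by (simp add: field_simps)
  \<comment> \<open>The quotient equals \<open>4 * \<gamma> + 1 / L\<close>. This bound controls
    both the coherence factor and \<open>exp (4 * x + 1)\<close>.\<close>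
  have aL: "(4 * x + 1) / L \<le> 1"
    using \<gamma> L0 by (simp add: x_def L_def[symmetric] add_divide_distrib)
  have sm: "s * m \<le> p" by (simp add: m_def)
  have m4: "4 * s \<le> m"
    unfolding m_def using p4n s by (simp add: less_eq_div_iff_mult_less_eq)
  have pm: "real p \<le> real s * real m + real s"
  proof -
    have "p \<le> s * m + s"
      using s mod_less_divisor[of s p] by (metis m_def mult_div_mod_eq add_left_mono less_imp_le)
    then show ?thesis by (simp only: of_nat_le_iff flip: of_nat_mult of_nat_add)
  qed
  have ea: "exp (4 * x + 1) \<le> real p / (real s)\<^sup>2"
  proof -
    have "exp (4 * x + 1) \<le> exp L" using aL L0 by (simp add: pos_divide_le_eq)
    also have "\<dots> = real p / (real s)\<^sup>2" unfolding L_def using R by (intro exp_ln) linarith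
    finally show ?thesis .
  qed
  \<comment> \<open>Since \<open>m\<close> is about \<open>p / s\<close>, the ratio
    \<open>(p / s^2) / m\<close> is about \<open>1 / s\<close>; the \<open>s - 1\<close> factors
    together stay below \<open>exp 1\<close>.\<close>
  have pw: "(1 + exp (4 * x + 1) / real m) ^ (s - 1) \<le> exp 1"
  proof -
    have m0: "0 < real m" using m4 s by simp
    have "(real s - 1) * real p \<le> (real s)\<^sup>2 * real m"
    proof -
      have "real s * real p \<le> real s * (real s * real m + real s)"
        using pm by (intro mult_left_mono) auto
      moreover have "(real s)\<^sup>2 \<le> real p"
        using p4 zero_le_power2[of "real s"] by linarith
      ultimately show ?thesis by (simp add: power2_eq_square algebra_simps)
    qed
    then have bd: "(real s - 1) * (real p / (real s)\<^sup>2 / real m) \<le> 1"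
      using s m0 by (simp add: field_simps)
    have "(1 + exp (4 * x + 1) / real m) ^ (s - 1) \<le> exp (real p / (real s)\<^sup>2 / real m) ^ (s - 1)"
    proof (rule power_mono)
      have "1 + exp (4 * x + 1) / real m \<le> 1 + real p / (real s)\<^sup>2 / real m"
        using ea m0 by (intro add_left_mono divide_right_mono) auto
      also have "\<dots> \<le> exp (real p / (real s)\<^sup>2 / real m)" by (rule exp_ge_add_one_self)
      finally show "1 + exp (4 * x + 1) / real m \<le> exp (real p / (real s)\<^sup>2 / real m)" .
    qed simp
    also have "\<dots> = exp ((real s - 1) * (real p / (real s)\<^sup>2 / real m))"
      using s by (simp add: exp_of_nat_mult[symmetric] of_nat_diff)
    also have "\<dots> \<le> exp 1" using bd by simp
    finally show ?thesis .
  qed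
  \<comment> \<open>One factor \<open>exp 1\<close> pays for the coherence, one for the
    \<open>+ 1\<close> in \<open>4 * x + 1\<close>, and one for the overlaps in the other
    \<open>s - 1\<close> blocks.\<close>
  define K where "K = exp 1 * (exp 1 * r * exp (1::real))"
  have K: "exp ((4 * x + 1) * (real s)\<^sup>2 * (1 / ((real s)\<^sup>2 * L))) *
      (exp (4 * x + 1) * (1 + exp (4 * x + 1) / real m) ^ (s - 1)) \<le> K"
    unfolding K_def
  proof (intro mult_mono)
    show "exp ((4 * x + 1) * (real s)\<^sup>2 * (1 / ((real s)\<^sup>2 * L))) \<le> exp 1"
      using aL s by simp
    show "exp (4 * x + 1) \<le> exp 1 * r" by (simp add: r_def exp_add)
  qed (use pw in \<open>auto simp: r_def\<close>)
  have M0: "regression_law n p X (zero_vec p) = std_gaussian_vec n"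
    by (rule regression_law_zero)
  let ?T = "(1 - (1/2) powr 0.01) / (25 * (exp 1)\<^sup>2 * L) * (real p / real n) * ((real s)\<^sup>2 / real p) powr (4 * \<gamma>)"
  have T: "?T \<le> real s * real m / (4 * real n * K)"
  proof -
    have r0: "0 < r" by (simp add: r_def)
    have "(real s)\<^sup>2 / real p = exp (- L)"
      using R unfolding L_def by (subst exp_minus, subst exp_ln) (auto simp: inverse_eq_divide)
    then have rr: "((real s)\<^sup>2 / real p) powr (4 * \<gamma>) = 1 / r"
      by (simp add: powr_def r_def x_def exp_minus[symmetric] inverse_eq_divide[symmetric] mult_ac)
    have "(1 - (1/2) powr 0.01) / (25 * (exp 1)\<^sup>2 * L) \<le> 1 / (25 * (exp (1::real))\<^sup>2 * 1)"
      using L1 by (intro frac_le mult_left_mono) auto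
    \<comment> \<open>This amounts to \<open>16 * exp 1 \<le> 75\<close>. The number 3/16 is 1/4
      from the variance bound times 3/4 from \<open>s * m \<ge> 3 / 4 * p\<close>.\<close>
    also have "\<dots> \<le> 3 / (16 * exp 1 ^ 3)"
      using exp_le by (simp add: field_simps power2_eq_square power3_eq_cube)
    finally have c: "(1 - (1/2) powr 0.01) / (25 * (exp 1)\<^sup>2 * L) \<le> 3 / (16 * exp (1::real) ^ 3)" .
    have "?T \<le> 3 / (16 * exp 1 ^ 3) * (real p / real n) * (1 / r)"
      unfolding rr using c r0 by (intro mult_right_mono) auto
    also have "\<dots> = (3 / 4 * real p) / (4 * real n * K)"
      by (simp add: K_def power3_eq_cube)
    also have "\<dots> \<le> real s * real m / (4 * real n * K)"
    proof (rule divide_right_mono)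
      have "4 * s * 1 \<le> 4 * s * s" using s by (intro mult_left_mono) auto
      then have "4 * s \<le> p" using p4n by linarith
      then have "4 * real s \<le> real p" by linarith
      then show "3 / 4 * real p \<le> real s * real m" using pm by linarith
    qed (auto simp: K_def r_def)
    finally show ?thesis .
  qed
  have "(\<Sum>i<p. ext_variance (std_gaussian_vec n) (\<lambda>y. b y i)) \<ge> ennreal ?T"
  \<comment> \<open>If some component is not square integrable, its variance is infinite and so is
    the sum.\<close>
  proof (cases "\<forall>i<p. integrable (std_gaussian_vec n) (\<lambda>y. (b y i)\<^sup>2)")
    case True
    have "ennreal ?T \<le> ennreal (real s * real m / (4 * real n * K))"
      using T by (rule ennreal_leI)
    also have "\<dots> \<le> ennreal (\<Sum>i<p. \<integral>y. (b y i - (\<integral>z. b z i \<partial>std_gaussian_vec n))\<^sup>2 \<partial>std_gaussian_vec n)"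
      using True m4 s L0
      by (intro ennreal_leI block_variance_bound[OF sm _ s x0 n est _ bias diag mc[folded L_def] _ K]) auto
    also have "\<dots> = (\<Sum>i<p. ext_variance (std_gaussian_vec n) (\<lambda>y. b y i))"
      using True by (subst sum_ennreal[symmetric]) (auto simp: ext_variance_def intro!: integral_nonneg_AE)
    finally show ?thesis .
  next
    case False
    then obtain i where "i < p" "ext_variance (std_gaussian_vec n) (\<lambda>y. b y i) = \<infinity>"
      by (auto simp: ext_variance_def)
    then have "(\<Sum>i<p. ext_variance (std_gaussian_vec n) (\<lambda>y. b y i)) = top"
      by (subst sum.remove[of _ i]) auto
    then show ?thesis by (simp only: top_greatest)
  qed
  then show "(\<Sum>i<p. ext_variance (regression_law n p X (zero_vec p)) (\<lambda>y. b y i))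
       \<ge> ennreal ((1 - (1/2) powr 0.01) / (25 * (exp 1)\<^sup>2 * ln (real p / (real s)\<^sup>2))
            * (real p / real n) * ((real s)\<^sup>2 / real p) powr (4 * \<gamma>))"
    by (simp only: M0 L_def)
qed

end
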